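(* Any streaming algorithm for \textsc{Diameter} in the VA model that works on all graphs $G$ having a set $X$ of $2$ vertices such that $G - X$ is a single clique, and that uses $p$ passes over the stream, requires $\Omega(n/p)$ bits of memory on $n$-vertex graphs.
   Context: Graphs are finite, simple, undirected, unweighted. \textsc{Diameter}: compute $\max_{s,t} d(s,t)$ (shortest-path distance). In the Vertex Arrival (VA) streaming model, the vertices arrive one by one in an arbitrary fixed order, and each edge is revealed when the later of its two endpoints arrives. A $p$-pass algorithm reads the stream $p$ times with unlimited computation; memory is measured in bits. "Requires $\Omega(f)$ bits" means there is a constant $c>0$ such that every such algorithm uses at least $c\cdot f$ bits on some $n$-vertex input of the class, for all sufficiently large $n$ and all $p$. *)

theory Defs
  imports "Graph_Theory.Graph_Theory"
begin

text \<open>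
  A finite simple undirected graph is a \<^const>\<open>pair_graph\<close>: finite, loop-free, with a symmetric
  arc relation. Distances count edges and are infinite between different components.
\<close>

definition diameter :: "'a pair_pre_digraph \<Rightarrow> ereal" where
  "diameter G = (SUP u\<in>pverts G. SUP v\<in>pverts G. wf_digraph.\<mu> (with_proj G) (\<lambda>_. 1) u v)"

definition clique_after_deleting :: "'a pair_pre_digraph \<Rightarrow> 'a set \<Rightarrow> bool" where
  "clique_after_deleting G X \<longleftrightarrow> X \<subseteq> pverts G \<and>
     complete_digraph (card (pverts G - X)) (with_proj G \<restriction> (pverts G - X))"

text \<open>
  Input graphs carry the vertex labels \<open>0, \<dots>, n - 1\<close>, so no information can be hidden in
  large labels.
\<close>

definition two_from_clique :: "nat pair_pre_digraph set" where
  "two_from_clique = {G. pair_graph G \<and> pverts G = {..<card (pverts G)} \<and>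
     (\<exists>X. card X = 2 \<and> clique_after_deleting G X)}"

definition arrival_order :: "'a pair_pre_digraph \<Rightarrow> 'a list \<Rightarrow> bool" where
  "arrival_order G vs \<longleftrightarrow> distinct vs \<and> set vs = pverts G"

text \<open>Each vertex arrives together with its edges to the vertices that arrived before it.\<close>

definition va_stream :: "'a pair_pre_digraph \<Rightarrow> 'a list \<Rightarrow> ('a \<times> 'a set) list" where
  "va_stream G vs =
     map (\<lambda>i. (vs ! i, {u \<in> set (take i vs). (u, vs ! i) \<in> parcs G})) [0..<length vs]"

text \<open>
  A deterministic multi-pass algorithm. Its memory content is a bit string of arbitrary, possibly
  varying, length. The first argument of every component is the number \<open>n\<close> of vertices, and the
  second argument of \<open>update\<close> is the number of items read so far over all passes: both are known
  to the algorithm without being charged as memory. The components are arbitrary functions, since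
  computation is unlimited.
\<close>

record va_algorithm =
  passes :: "nat \<Rightarrow> nat"
  initial :: "nat \<Rightarrow> bool list"
  update :: "nat \<Rightarrow> nat \<Rightarrow> bool list \<Rightarrow> nat \<times> nat set \<Rightarrow> bool list"
  answer :: "nat \<Rightarrow> bool list \<Rightarrow> ereal"

text \<open>
  Memory content after \<open>k\<close> items have been read. Passes follow each other without a break, so the
  item read next is the one at position \<open>k mod length xs\<close> of pass \<open>k div length xs\<close>.
\<close>

primrec memory_after :: "va_algorithm \<Rightarrow> (nat \<times> nat set) list \<Rightarrow> nat \<Rightarrow> bool list" where
  "memory_after A xs 0 = initial A (length xs)"
| "memory_after A xs (Suc k) =
     update A (length xs) k (memory_after A xs k) (xs ! (k mod length xs))"

definition items_read :: "va_algorithm \<Rightarrow> (nat \<times> nat set) list \<Rightarrow> nat" where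
  "items_read A xs = passes A (length xs) * length xs"

definition result :: "va_algorithm \<Rightarrow> (nat \<times> nat set) list \<Rightarrow> ereal" where
  "result A xs = answer A (length xs) (memory_after A xs (items_read A xs))"

definition bits_used :: "va_algorithm \<Rightarrow> (nat \<times> nat set) list \<Rightarrow> nat" where
  "bits_used A xs = Max ((\<lambda>k. length (memory_after A xs k)) ` {..items_read A xs})"

definition computes_diameter_on :: "va_algorithm \<Rightarrow> nat pair_pre_digraph set \<Rightarrow> bool" where
  "computes_diameter_on A C \<longleftrightarrow>
     (\<forall>G\<in>C. \<forall>vs. arrival_order G vs \<longrightarrow> result A (va_stream G vs) = diameter G)"

end

theory Submission
  imports Defs
begin

text \<open>
  The reduction is from set disjointness. A clique arrives first, then a vertex \<open>x\<close> with
  neighbourhood \<open>S\<close> in the clique, then a vertex \<open>y\<close> with neighbourhood \<open>T\<close>; the diameter is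
  \<open>3\<close> if the nonempty sets \<open>S\<close> and \<open>T\<close> are disjoint and at most \<open>2\<close> otherwise. The pairs \<open>(S, - S)\<close> form a fooling
  set: the memory contents just before and just after each reading of \<open>y\<close> make up a transcript
  with the rectangle property, so distinct \<open>S\<close> have distinct transcripts. With at most \<open>M\<close> bits
  there are at most \<open>2\<^bsup>4 M p\<^esup>\<close> transcripts, against exponentially many sets \<open>S\<close>.
\<close>

section \<open>The graph family and its stream\<close>

text \<open>The vertex \<open>x\<close> of the reduction is \<open>k\<close> and \<open>y\<close> is
  \<open>Suc k\<close>. Each edge is listed from its later endpoint \<open>v\<close>, matching the
  arrival order. The guard \<open>u < v\<close> excludes loops, so every choice of \<open>S\<close>
  and \<open>T\<close> gives a legal input.\<close>

definition disjointness_graph :: "nat \<Rightarrow> nat set \<Rightarrow> nat set \<Rightarrow> nat pair_pre_digraph" where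
  "disjointness_graph k S T =
     (let F = {(u, v). u < v \<and> (v < k \<or> v = k \<and> u \<in> S \<or> v = Suc k \<and> u \<in> T)}
      in \<lparr>pverts = {..<k + 2}, parcs = F \<union> F\<inverse>\<rparr>)"

lemma pverts_disjointness_graph [simp]: "pverts (disjointness_graph k S T) = {..<k + 2}"
  by (simp add: disjointness_graph_def Let_def)

lemma parcs_disjointness_graph:
  "(u, v) \<in> parcs (disjointness_graph k S T) \<longleftrightarrow>
     u < v \<and> (v < k \<or> v = k \<and> u \<in> S \<or> v = Suc k \<and> u \<in> T) \<or>
     v < u \<and> (u < k \<or> u = k \<and> v \<in> S \<or> u = Suc k \<and> v \<in> T)"
  by (auto simp: disjointness_graph_def Let_def)

lemma pair_graph_disjointness_graph: "pair_graph (disjointness_graph k S T)"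
proof -
  have "parcs (disjointness_graph k S T) \<subseteq> {..<k + 2} \<times> {..<k + 2}"
    by (auto simp: parcs_disjointness_graph)
  then have "finite (parcs (disjointness_graph k S T))"
    by (rule finite_subset) auto
  then show ?thesis
    by unfold_locales (auto simp: parcs_disjointness_graph symmetric_def intro!: symI)
qed

lemma disjointness_graph_two_from_clique: "disjointness_graph k S T \<in> two_from_clique"
proof -
  let ?G = "disjointness_graph k S T" and ?X = "{k, Suc k}"
  have V: "pverts ?G - ?X = {..<k}"
    by auto
  have "with_proj ?G \<restriction> {..<k}
      = with_proj \<lparr>pverts = {..<k}, parcs = {(u, v). u < k \<and> v < k \<and> u \<noteq> v}\<rparr>"
    by (auto simp: induce_subgraph_def with_proj_def parcs_disjointness_graph)
  then have "clique_after_deleting ?G ?X"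
    unfolding clique_after_deleting_def V by (simp add: complete_digraph_pair_def)
  moreover have "card ?X = 2"
    by simp
  ultimately have "\<exists>X. card X = 2 \<and> clique_after_deleting ?G X"
    by blast
  then show ?thesis
    by (simp add: two_from_clique_def pair_graph_disjointness_graph)
qed

lemma va_stream_disjointness_graph:
  assumes "S \<subseteq> {..<k}" "T \<subseteq> {..<k}"
  shows "va_stream (disjointness_graph k S T) [0..<k + 2]
     = map (\<lambda>i. (i, {..<i})) [0..<k] @ [(k, S), (Suc k, T)]"
  using assms
  by (auto simp: va_stream_def parcs_disjointness_graph nth_append take_Cons')

section \<open>Distances and the diameter\<close>

lemma diameter_le_2:
  assumes "pair_wf_digraph G"
    and "\<And>u v. u \<in> pverts G \<Longrightarrow> v \<in> pverts G \<Longrightarrow>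
      u = v \<or> (u, v) \<in> parcs G \<or> (\<exists>w. (u, w) \<in> parcs G \<and> (w, v) \<in> parcs G)"
  shows "diameter G \<le> 2"
proof -
  interpret pair_wf_digraph G by fact
  have "wf_digraph.\<mu> (with_proj G) (\<lambda>_. 1) u v \<le> 2" if uv: "u \<in> pverts G" "v \<in> pverts G" for u v
  proof -
    obtain p where "awalk u p v" "length p \<le> 2"
    proof -
      consider "u = v" | "(u, v) \<in> parcs G" | w where "(u, w) \<in> parcs G" "(w, v) \<in> parcs G"
        using assms(2)[OF uv] by blast
      then show thesis
      proof cases
        case 1
        then show thesis using \<open>u \<in> pverts G\<close> by (intro that[of "[]"]) (auto simp: awalk_def)
      next
        case 2
        then show thesis using \<open>u \<in> pverts G\<close> by (intro that[of "[(u, v)]"]) (auto simp: awalk_def)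
      next
        case 3
        then show thesis
          using \<open>u \<in> pverts G\<close> by (intro that[of "[(u, w), (w, v)]"]) (auto simp: awalk_def)
      qed
    qed
    then have "\<mu> (\<lambda>_. 1) u v \<le> ereal (real (length p))"
      using min_cost_le_walk_cost[of u p v "\<lambda>_. 1"] by (simp add: awalk_cost_def sum_list_triv)
    also have "\<dots> \<le> 2"
      using \<open>length p \<le> 2\<close> by simp
    finally show ?thesis .
  qed
  then show ?thesis
    unfolding diameter_def by (intro SUP_least)
qed

text \<open>Distance is an infimum over walks, so it is enough that no walk from \<open>u\<close> to
  \<open>v\<close> has fewer than three arcs. This covers the case without any walk, where the
  distance is infinite.\<close>

lemma diameter_ge_3:
  assumes "pair_wf_digraph G" "u \<in> pverts G" "v \<in> pverts G" "u \<noteq> v" "(u, v) \<notin> parcs G"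
    and "\<And>w. (u, w) \<in> parcs G \<Longrightarrow> (w, v) \<notin> parcs G"
  shows "3 \<le> diameter G"
proof -
  interpret pair_wf_digraph G by fact
  have "3 \<le> length p" if "awalk u p v" for p
    using that assms by (cases p rule: list.exhaust; cases "tl p"; cases "tl (tl p)")
      (auto simp: awalk_def)
  then have "3 \<le> \<mu> (\<lambda>_. 1) u v"
    unfolding \<mu>_def by (intro INF_greatest) (auto simp: awalk_cost_def sum_list_triv)
  also have "\<dots> \<le> diameter G"
    unfolding diameter_def using assms(2,3) by (intro SUP_upper2[of u] SUP_upper) auto
  finally show ?thesis .
qed

text \<open>A common neighbour of \<open>k\<close> and \<open>Suc k\<close> is adjacent to all other
  vertices, so any two vertices are at distance at most two through it. Without one,
  \<open>k\<close> and \<open>Suc k\<close> are themselves too far apart.\<close>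

lemma diameter_disjointness_graph:
  assumes "S \<subseteq> {..<k}" "T \<subseteq> {..<k}" "S \<noteq> {}" "T \<noteq> {}"
  shows "diameter (disjointness_graph k S T) \<le> 2 \<longleftrightarrow> S \<inter> T \<noteq> {}"
proof -
  have wf: "pair_wf_digraph (disjointness_graph k S T)"
    using pair_graph_disjointness_graph by (rule pair_digraph.pair_wf_digraph[OF pair_graph.axioms(1)])
  show ?thesis
  proof (cases "S \<inter> T = {}")
    case True
    have "3 \<le> diameter (disjointness_graph k S T)"
      by (rule diameter_ge_3[OF wf, of k "Suc k"])
        (use assms True in \<open>auto simp: parcs_disjointness_graph\<close>)
    moreover have "(2::ereal) < 3"
      by simp
    ultimately have "\<not> diameter (disjointness_graph k S T) \<le> 2"
      by (meson leD le_less_trans order_trans)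
    then show ?thesis using True by simp
  next
    case False
    then obtain a where a: "a \<in> S" "a \<in> T" by blast
    have "diameter (disjointness_graph k S T) \<le> 2"
    proof (rule diameter_le_2[OF wf])
      fix u v
      assume "u \<in> pverts (disjointness_graph k S T)" "v \<in> pverts (disjointness_graph k S T)"
      then have uv: "u < k + 2" "v < k + 2" by auto
      have "a < k" using a assms by auto
      have "u = v \<or> (u, v) \<in> parcs (disjointness_graph k S T) \<or> 
          ((u, a) \<in> parcs (disjointness_graph k S T) \<and> (a, v) \<in> parcs (disjointness_graph k S T))"
        using uv a \<open>a < k\<close> unfolding parcs_disjointness_graph by (auto simp: less_Suc_eq)
      then show "u = v \<or> (u, v) \<in> parcs (disjointness_graph k S T) \<or> (\<exists>w.
          (u, w) \<in> parcs (disjointness_graph k S T) \<and> (w, v) \<in> parcs (disjointness_graph k S T))"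
        by blast
    qed
    then show ?thesis using False by simp
  qed
qed

section \<open>Transcripts and the rectangle property\<close>

text \<open>Entry \<open>j\<close> brackets the last item of pass \<open>j\<close>, which is where
  \<open>y\<close> arrives. Using \<open>restrict\<close> fixes the values beyond the last pass, so
  that transcripts lie in a finite function space.\<close>

definition transcript ::
  "va_algorithm \<Rightarrow> (nat \<times> nat set) list \<Rightarrow> nat \<Rightarrow> bool list \<times> bool list" where
  "transcript A xs = restrict
     (\<lambda>j. (memory_after A xs (j * length xs + (length xs - 1)),
           memory_after A xs (Suc j * length xs)))
     {..<passes A (length xs)}"

text \<open>The mixed run treats the items of \<open>us\<close> as the run on
  \<open>us @ [b]\<close> does. It reaches the last item with a content that both given runs share
  there, reads \<open>b'\<close> as the second run does, and hence leaves with the content that they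
  share afterwards.\<close>

lemma memory_after_rectangle:
  assumes len: "length us = length us'"
    and tr: "transcript A (us @ [b]) = transcript A (us' @ [b'])"
    and k: "k \<le> items_read A (us @ [b])"
  shows "memory_after A (us @ [b']) k = memory_after A (us @ [b]) k"
  using k
proof (induction k)
  case 0
  then show ?case by simp
next
  case (Suc k)
  define n where "n = Suc (length us)"
  have IH: "memory_after A (us @ [b']) k = memory_after A (us @ [b]) k"
    using Suc by simp
  show ?case
  proof (cases "k mod n = length us")
    case False
    have "k mod n < Suc (length us)"
      unfolding n_def by (rule mod_less_divisor) simp
    then have "k mod n < length us"
      using False unfolding n_def by linarith
    then show ?thesis using IH by (simp add: n_def nth_append)
  next
    case True
    \<comment> \<open>Here \<open>k\<close> and \<open>Suc k\<close> are exactly the two moments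
      recorded in entry \<open>j\<close>.\<close>
    define j where "j = k div n"
    have kj: "k = j * n + length us" 
      unfolding j_def True[symmetric] by simp
    have "k < passes A n * n"
      using Suc.prems by (simp add: items_read_def n_def)
    then have "j < passes A n"
      unfolding j_def by (simp add: less_mult_imp_div_less)
    moreover have "j * n + (n - 1) = k" "Suc j * n = Suc k"
      using kj by (simp_all add: n_def)
    moreover have "length (us @ [b]) = n" "length (us' @ [b']) = n"
      using len by (simp_all add: n_def)
    ultimately have "memory_after A (us @ [b]) k = memory_after A (us' @ [b']) k"
        "memory_after A (us @ [b]) (Suc k) = memory_after A (us' @ [b']) (Suc k)"
      using fun_cong[OF tr, of j]
      by (simp_all only: transcript_def restrict_apply lessThan_iff if_True prod.inject)
    then show ?thesis using IH True len by (simp add: n_def nth_append)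
  qed
qed

lemma result_rectangle:
  assumes "length us = length us'"
    and "transcript A (us @ [b]) = transcript A (us' @ [b'])"
  shows "result A (us @ [b']) = result A (us @ [b])"
  using memory_after_rectangle[OF assms order_refl] by (simp add: result_def items_read_def)

section \<open>Counting transcripts\<close>

lemma bits_used_ge: "k \<le> items_read A xs \<Longrightarrow> length (memory_after A xs k) \<le> bits_used A xs"
  unfolding bits_used_def by (intro Max_ge) auto

lemma transcript_in_PiE:
  assumes "bits_used A xs \<le> M" "xs \<noteq> []"
  shows "transcript A xs \<in> {..<passes A (length xs)} \<rightarrow>\<^sub>E {bs. length bs \<le> M} \<times> {bs. length bs \<le> M}"
proof -
  have "j * length xs + (length xs - 1) \<le> items_read A xs \<and> Suc j * length xs \<le> items_read A xs"
    if "j < passes A (length xs)" for j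
  proof -
    have "Suc j * length xs \<le> items_read A xs"
      unfolding items_read_def using that by (intro mult_le_mono1) simp
    then show ?thesis by simp
  qed
  then show ?thesis
    using assms(1) order_trans[OF bits_used_ge] unfolding transcript_def by (auto simp del: mult_Suc)
qed

text \<open>The exact count is \<open>2 ^ (M + 1) - 1\<close>. Rounding it up to
  \<open>4 ^ M\<close> keeps the exponent a multiple of \<open>M\<close>, with no additive term that
  would grow with the number of passes.\<close>

lemma
  shows finite_bool_lists_le: "finite {bs::bool list. length bs \<le> M}"
    and card_bool_lists_le: "card {bs::bool list. length bs \<le> M} \<le> 4 ^ M"
proof -
  show "finite {bs::bool list. length bs \<le> M}"
    using finite_lists_length_le[of "UNIV :: bool set" M] by simp
  have "card {bs::bool list. length bs \<le> M} = (\<Sum>i\<le>M. 2 ^ i)"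
    using card_lists_length_le[of "UNIV :: bool set" M] by simp
  also have "\<dots> \<le> 4 ^ M"
  proof (induction M)
    case (Suc M)
    have "(2::nat) ^ M \<le> 4 ^ M" by (intro power_mono) auto
    then show ?case using Suc by simp
  qed simp
  finally show "card {bs::bool list. length bs \<le> M} \<le> 4 ^ M" .
qed

lemma fooling_set_bound:
  assumes "finite \<S>" and "\<And>S. S \<in> \<S> \<Longrightarrow> length (f S) = n \<and> bits_used A (f S) \<le> M" and "0 < n"
    and "inj_on (\<lambda>S. transcript A (f S)) \<S>"
  shows "card \<S> \<le> 2 ^ (4 * M * passes A n)"
proof -
  let ?L = "{bs::bool list. length bs \<le> M}"
  have fin: "finite ({..<passes A n} \<rightarrow>\<^sub>E ?L \<times> ?L)"
    by (intro finite_PiE) (auto simp: finite_bool_lists_le)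
  have "(\<lambda>S. transcript A (f S)) ` \<S> \<subseteq> {..<passes A n} \<rightarrow>\<^sub>E ?L \<times> ?L"
    using assms(2,3) transcript_in_PiE by blast
  then have "card \<S> \<le> card ({..<passes A n} \<rightarrow>\<^sub>E ?L \<times> ?L)"
    by (rule card_inj_on_le[OF assms(4) _ fin])
  also have "\<dots> = (card ?L * card ?L) ^ passes A n"
    by (simp add: card_PiE card_cartesian_product)
  also have "\<dots> \<le> (4 ^ M * 4 ^ M) ^ passes A n"
    by (intro power_mono mult_mono card_bool_lists_le) auto
  also have "(4 ^ M * 4 ^ M :: nat) = 2 ^ (4 * M)"
    using power_mult[of "2::nat" 4 M] by (simp flip: power_mult_distrib)
  finally show ?thesis by (simp add: power_mult)
qed

section \<open>The fooling set and the lower bound\<close>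

text \<open>If \<open>S\<close> and \<open>S'\<close> share a transcript, pairing \<open>S\<close>
  with the complement of \<open>S'\<close> gives the same answer as the disjoint pair of
  \<open>S\<close> and its own complement. So the mixed pair is disjoint too, that is,
  \<open>S \<subseteq> S'\<close>; equality follows by symmetry. Leaving out the empty and the full
  set keeps both sides of every pair nonempty, as \<open>diameter_disjointness_graph\<close>
  demands.\<close>

lemma inj_on_transcript_disjointness_graph:
  assumes "computes_diameter_on A two_from_clique"
  shows "inj_on (\<lambda>S. transcript A (va_stream (disjointness_graph k S ({..<k} - S)) [0..<k + 2]))
     (Pow {..<k} - {{}, {..<k}})"
proof -
  let ?stream = "\<lambda>S T. va_stream (disjointness_graph k S T) [0..<k + 2]"
  have res: "result A (?stream S T) = diameter (disjointness_graph k S T)" for S T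
  proof -
    have "arrival_order (disjointness_graph k S T) [0..<k + 2]"
      by (auto simp: arrival_order_def)
    then show ?thesis
      using assms disjointness_graph_two_from_clique unfolding computes_diameter_on_def by blast
  qed
  have sub: "S \<subseteq> S'"
    if S: "S \<subseteq> {..<k}" "S \<noteq> {}" "S \<noteq> {..<k}" and S': "S' \<subseteq> {..<k}" "S' \<noteq> {}" "S' \<noteq> {..<k}"
      and tr: "transcript A (?stream S ({..<k} - S)) = transcript A (?stream S' ({..<k} - S'))"
    for S S'
  proof -
    define us where "us S = map (\<lambda>i. (i, {..<i})) [0..<k] @ [(k, S)]" for S
    have str: "?stream S T = us S @ [(Suc k, T)]" if "S \<subseteq> {..<k}" "T \<subseteq> {..<k}" for S T
      using va_stream_disjointness_graph[OF that] by (simp add: us_def del: upt_Suc)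
    have "result A (us S @ [(Suc k, {..<k} - S')]) = result A (us S @ [(Suc k, {..<k} - S)])"
    proof (rule result_rectangle)
      show "length (us S) = length (us S')"
        by (simp add: us_def)
      show "transcript A (us S @ [(Suc k, {..<k} - S)]) = transcript A (us S' @ [(Suc k, {..<k} - S')])"
        using tr S(1) S'(1) by (simp only: str Diff_subset)
    qed
    then have "result A (?stream S ({..<k} - S')) = result A (?stream S ({..<k} - S))"
      using S(1) by (simp only: str Diff_subset)
    then have "diameter (disjointness_graph k S ({..<k} - S'))
        = diameter (disjointness_graph k S ({..<k} - S))"
      unfolding res .
    then have "S \<inter> ({..<k} - S') = {}"
      using diameter_disjointness_graph[of S k "{..<k} - S'"]
        diameter_disjointness_graph[of S k "{..<k} - S"] S S' by auto
    then show ?thesis using S by auto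
  qed
  show ?thesis
    by (intro inj_onI subset_antisym; rule sub) auto
qed

theorem theorem18:
  shows "\<exists>c::real. c > 0 \<and> (\<exists>n0::nat. \<forall>n\<ge>n0. \<forall>p\<ge>1. \<forall>A::va_algorithm.
    computes_diameter_on A two_from_clique \<and> passes A n = p \<longrightarrow>
    (\<exists>G\<in>two_from_clique. \<exists>vs. card (pverts G) = n \<and> arrival_order G vs \<and>
      c * (real n / real p) \<le> real (bits_used A (va_stream G vs))))"
proof (rule exI[of _ "1 / 8"], intro conjI exI[of _ 6] allI impI)
  fix n p :: nat and A
  assume n: "n \<ge> 6" and p: "p \<ge> 1"
    and A: "computes_diameter_on A two_from_clique \<and> passes A n = p"
  define k where "k = n - 2"
  have k: "n = k + 2" "k \<ge> 4" using n by (auto simp: k_def)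
  define G where "G S = disjointness_graph k S ({..<k} - S)" for S
  define f where "f S = va_stream (G S) [0..<k + 2]" for S
  define \<S> where "\<S> = Pow {..<k} - {{}, {..<k}}"
  \<comment> \<open>The maximum is attained on the fooling set, so a lower bound on \<open>M\<close>
    is one for a concrete input.\<close>
  define M where "M = Max ((\<lambda>S. bits_used A (f S)) ` \<S>)"
  have fin: "finite \<S>" by (simp add: \<S>_def)
  have card: "card \<S> = 2 ^ k - 2"
  proof -
    have "0 \<in> {..<k}" using k by simp
    then have "card {{}, {..<k}} = 2" by (metis card_2_iff empty_iff)
    then show ?thesis
      by (simp add: \<S>_def card_Diff_subset card_Pow)
  qed
  \<comment> \<open>At least half of all subsets remain, which leaves a pure power of two and allows
    exponents to be compared.\<close>
  have pow: "(2::nat) ^ k = 2 * 2 ^ (k - 1)"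
    using k by (simp flip: power_Suc)
  have "(2::nat) ^ 1 \<le> 2 ^ (k - 1)"
    using k by (intro power_increasing) auto
  then have ge: "2 ^ (k - 1) \<le> card \<S>"
    unfolding card pow by simp
  then have "\<S> \<noteq> {}"
    by auto
  then have "M \<in> (\<lambda>S. bits_used A (f S)) ` \<S>"
    unfolding M_def using fin by (intro Max_in) auto
  then obtain S where S: "S \<in> \<S>" "M = bits_used A (f S)"
    by auto
  have "card \<S> \<le> 2 ^ (4 * M * passes A n)"
  proof (rule fooling_set_bound[OF fin, of f])
    show "length (f S) = n \<and> bits_used A (f S) \<le> M" if "S \<in> \<S>" for S
      using that fin k by (auto simp: f_def va_stream_def M_def intro!: Max_ge)
    show "inj_on (\<lambda>S. transcript A (f S)) \<S>"
      using inj_on_transcript_disjointness_graph A unfolding f_def G_def \<S>_def by blast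
  qed (use n in simp)
  then have "(2::nat) ^ (k - 1) \<le> 2 ^ (4 * M * p)"
    using ge A by (metis order_trans)
  then have "k - 1 \<le> 4 * M * p"
    by (rule power_le_imp_le_exp[rotated]) simp
  \<comment> \<open>Since \<open>n = (k - 1) + 3\<close> and \<open>k \<ge> 4\<close> gives
    \<open>3 \<le> k - 1\<close>, both summands are at most \<open>4 * M * p\<close>. This fixes the
    constant \<open>1 / 8\<close> and the threshold \<open>6\<close>.\<close>
  then have "n \<le> 8 * (M * p)"
    using k by simp
  then have "real n \<le> 8 * (real M * real p)"
    by (metis of_nat_le_iff of_nat_mult of_nat_numeral)
  then have "1 / 8 * (real n / real p) \<le> real M"
    using p by (simp add: field_simps)
  moreover have "G S \<in> two_from_clique" "card (pverts (G S)) = n" "arrival_order (G S) [0..<k + 2]"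
    using k by (auto simp: G_def disjointness_graph_two_from_clique arrival_order_def)
  ultimately show "\<exists>G\<in>two_from_clique. \<exists>vs. card (pverts G) = n \<and> arrival_order G vs \<and>
      1 / 8 * (real n / real p) \<le> real (bits_used A (va_stream G vs))"
    using S(2) unfolding f_def by blast
qed simp

end
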